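(* Let $M=\mathbb{R}^2$ with points $(s,t)$, and let $c_L\colon M\times M\to\mathbb{R}\cup\{\infty\}$ be the negative Lorentzian distance of $2$-dimensional Minkowski space, $$c_L((s,t),(s',t'))=\begin{cases}-\sqrt{(t'-t)^2-(s'-s)^2},& t'-t\ge|s'-s|,\\ \infty,&\text{otherwise.}\end{cases}$$ Let $i_0(s)=(s,0)$, $i_1(s)=(s,1)$, let $\mathcal{L}_1$ be the Lebesgue measure on $\mathbb{R}$, and set $\overline{\mu}=(i_0)_\sharp(\mathcal{L}_1|_{[0,1]})$ and $\overline{\nu}=(i_1)_\sharp(\mathcal{L}_1|_{[1,2]})$. Then the dual Kantorovich problem (DKP) for $(\overline{\mu},\overline{\nu})$ does not have a solution.
   Context: A coupling is optimal if it minimizes $\int c_L\,d\pi$ among all couplings of the two measures. A function $\psi\colon M\to\mathbb{R}\cup\{\infty\}$, $\psi\not\equiv\infty$, is $c_L$-convex if there is $\zeta\colon M\to\mathbb{R}\cup\{\pm\infty\}$ with $\psi(x)=\sup_{y\in M}\{\zeta(y)-c_L(x,y)\}$ for all $x\in M$ (with $\infty-\infty=-\infty$). Its $c_L$-transform is $\psi^{c_L}(y)=\inf_{x\in M}\{\psi(x)+c_L(x,y)\}$. A $c_L$-convex function $\psi$ is a solution to the DKP for $(\mu,\nu)$ if $\psi$ is $\mu$-almost surely finite and $\psi^{c_L}(y)-\psi(x)=c_L(x,y)$ $\pi$-almost surely for every optimal coupling $\pi$ of $\mu$ and $\nu$. *)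

theory Defs
  imports "HOL-Probability.Probability"
begin

section \<open>Optimal couplings\<close>

definition couplings :: "'a measure \<Rightarrow> 'b measure \<Rightarrow> ('a \<times> 'b) measure set" where
  "couplings \<mu> \<nu> =
     {\<pi>. sets \<pi> = sets (\<mu> \<Otimes>\<^sub>M \<nu>) \<and> distr \<pi> \<mu> fst = \<mu> \<and> distr \<pi> \<nu> snd = \<nu>}"

text \<open>
  The integral of an extended-real cost, as the integral of the positive part minus that of the
  negative part: \<^const>\<open>e2ennreal\<close> sends negative values to 0. The value is meaningful only if one
  of the two integrals is finite; for costs that are bounded below \<open>\<pi>\<close>-almost everywhere and
  finite \<open>\<pi>\<close>, the second one always is.
\<close>

definition transport_cost :: "('a \<Rightarrow> 'b \<Rightarrow> ereal) \<Rightarrow> ('a \<times> 'b) measure \<Rightarrow> ereal" where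
  "transport_cost c \<pi> =
     enn2ereal (\<integral>\<^sup>+ (x, y). e2ennreal (c x y) \<partial>\<pi>) - enn2ereal (\<integral>\<^sup>+ (x, y). e2ennreal (- c x y) \<partial>\<pi>)"

definition optimal_coupling ::
    "('a \<Rightarrow> 'b \<Rightarrow> ereal) \<Rightarrow> 'a measure \<Rightarrow> 'b measure \<Rightarrow> ('a \<times> 'b) measure \<Rightarrow> bool" where
  "optimal_coupling c \<mu> \<nu> \<pi> \<longleftrightarrow>
     \<pi> \<in> couplings \<mu> \<nu> \<and> (\<forall>\<pi>' \<in> couplings \<mu> \<nu>. transport_cost c \<pi> \<le> transport_cost c \<pi>')"


section \<open>The dual Kantorovich problem\<close>

text \<open>
  Subtraction with \<open>\<infinity> - \<infinity> = -\<infinity>\<close>; the library's subtraction on \<^typ>\<open>ereal\<close> has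
  \<open>\<infinity> - \<infinity> = \<infinity>\<close>.
\<close>

definition ereal_diff :: "ereal \<Rightarrow> ereal \<Rightarrow> ereal" where
  "ereal_diff a b = (if a = \<infinity> \<and> b = \<infinity> then -\<infinity> else a - b)"

definition c_convex :: "('a \<Rightarrow> 'b \<Rightarrow> ereal) \<Rightarrow> ('a \<Rightarrow> ereal) \<Rightarrow> bool" where
  "c_convex c \<psi> \<longleftrightarrow>
     (\<forall>x. \<psi> x \<noteq> -\<infinity>) \<and> (\<exists>x. \<psi> x \<noteq> \<infinity>) \<and>
     (\<exists>\<zeta> :: 'b \<Rightarrow> ereal. \<forall>x. \<psi> x = (SUP y. ereal_diff (\<zeta> y) (c x y)))"

definition c_transform :: "('a \<Rightarrow> 'b \<Rightarrow> ereal) \<Rightarrow> ('a \<Rightarrow> ereal) \<Rightarrow> 'b \<Rightarrow> ereal" where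
  "c_transform c \<psi> y = (INF x. \<psi> x + c x y)"

definition DKP_solution ::
    "('a \<Rightarrow> 'b \<Rightarrow> ereal) \<Rightarrow> 'a measure \<Rightarrow> 'b measure \<Rightarrow> ('a \<Rightarrow> ereal) \<Rightarrow> bool" where
  "DKP_solution c \<mu> \<nu> \<psi> \<longleftrightarrow>
     c_convex c \<psi> \<and> (AE x in \<mu>. \<bar>\<psi> x\<bar> \<noteq> \<infinity>) \<and>
     (\<forall>\<pi>. optimal_coupling c \<mu> \<nu> \<pi> \<longrightarrow>
        (AE (x, y) in \<pi>. ereal_diff (c_transform c \<psi> y) (\<psi> x) = c x y))"


section \<open>Two-dimensional Minkowski space\<close>

text \<open>Points are \<open>(s, t)\<close>, with the time coordinate second.\<close>

definition c_L :: "real \<times> real \<Rightarrow> real \<times> real \<Rightarrow> ereal" where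
  "c_L = (\<lambda>(s, t) (s', t').
     if t' - t \<ge> \<bar>s' - s\<bar> then ereal (- sqrt ((t' - t)\<^sup>2 - (s' - s)\<^sup>2)) else \<infinity>)"

definition i0 :: "real \<Rightarrow> real \<times> real" where
  "i0 s = (s, 0)"

definition i1 :: "real \<Rightarrow> real \<times> real" where
  "i1 s = (s, 1)"

definition mu_bar :: "(real \<times> real) measure" where
  "mu_bar = distr (restrict_space lborel {0..1}) borel i0"

definition nu_bar :: "(real \<times> real) measure" where
  "nu_bar = distr (restrict_space lborel {1..2}) borel i1"

end

theory Submission
  imports Defs
begin

text \<open>
  A point of the first segment sends mass to a causally later point of the second one only if its
  spatial coordinate grows by at most 1. The target is the source translated by \<open>(1, 1)\<close>, so on
  average the spatial coordinate grows by exactly 1; hence a coupling of finite cost moves almost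
  every point by exactly \<open>(1, 1)\<close>, along a light ray and at cost 0
  (\<open>coupling_in_future_is_translation\<close>). The translation is therefore an optimal coupling
  (\<open>optimal_translation_coupling\<close>), and a solution \<open>\<psi>\<close> of the dual problem has to be tight on
  its graph: \<open>f s = \<psi> (s, 0)\<close> is finite and equals the transform of \<open>\<psi>\<close> at \<open>(s + 1, 1)\<close> for
  almost every \<open>s \<in> {0..1}\<close>.

  Tightness cannot hold on such a large set, because the optimal transport runs entirely along
  light rays, where the Lorentzian distance grows like a square root. If \<open>a < b\<close> are two such
  parameters, then testing the transform at \<open>(a + 1, 1)\<close> with the point \<open>(b, 0)\<close> gives
  \<open>f b - f a \<ge> sqrt (1 - (1 - (b - a))\<^sup>2) \<ge> sqrt (b - a)\<close>. The square root is much larger than its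
  argument near 0, so adding up this estimate over a fine subdivision of an interval gives an
  arbitrarily large lower bound for the increment of \<open>f\<close> (\<open>no_sqrt_expanding_function\<close>), which
  contradicts finiteness.
\<close>

section \<open>Functions with square-root growth\<close>

text \<open>
  The expansion estimate improves itself: splitting an interval at a point of its middle third
  leaves two pieces of at least a third of its length, so that a lower bound
  \<open>K * sqrt (b - a)\<close> for all increments implies the bound \<open>(2 / sqrt 3) * K * sqrt (b - a)\<close>.
  Splitting at approximate midpoints requires only a weak density of \<open>G\<close>, whereas equidistant
  subdivisions would have to lie exactly in \<open>G\<close>.
\<close>

lemma no_sqrt_expanding_function:
  fixes f :: "real \<Rightarrow> real"
  assumes dense: "\<And>a b. a \<in> G \<Longrightarrow> b \<in> G \<Longrightarrow> a < b \<Longrightarrow>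
      \<exists>c\<in>G. a + (b - a) / 3 \<le> c \<and> c \<le> b - (b - a) / 3"
    and expanding: "\<And>a b. a \<in> G \<Longrightarrow> b \<in> G \<Longrightarrow> a < b \<Longrightarrow> sqrt (b - a) \<le> f b - f a"
    and "a \<in> G" "b \<in> G" "a < b"
  shows False
proof -
  have iterate: "(2 / sqrt 3) ^ n * sqrt (b - a) \<le> f b - f a"
    if "a \<in> G" "b \<in> G" "a < b" for n a b
    using that
  proof (induction n arbitrary: a b)
    case 0
    then show ?case using expanding by simp
  next
    case (Suc n)
    obtain c where c: "c \<in> G" "a + (b - a) / 3 \<le> c" "c \<le> b - (b - a) / 3"
      using dense[OF Suc.prems] by blast
    let ?K = "(2 / sqrt 3) ^ n" and ?r = "sqrt ((b - a) / 3)"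
    have "a < c" "c < b"
      using c(2,3) \<open>a < b\<close> by (auto simp: field_simps)
    have "?K * ?r \<le> f c - f a"
    proof -
      have "?K * ?r \<le> ?K * sqrt (c - a)"
        using c(2) by (intro mult_left_mono real_sqrt_le_mono) (linarith, simp)
      also have "\<dots> \<le> f c - f a"
        by (rule Suc.IH) fact+
      finally show ?thesis .
    qed
    moreover have "?K * ?r \<le> f b - f c"
    proof -
      have "?K * ?r \<le> ?K * sqrt (b - c)"
        using c(3) by (intro mult_left_mono real_sqrt_le_mono) (linarith, simp)
      also have "\<dots> \<le> f b - f c"
        by (rule Suc.IH) fact+
      finally show ?thesis .
    qed
    moreover have "(2 / sqrt 3) ^ Suc n * sqrt (b - a) = ?K * ?r + ?K * ?r"
      by (simp add: real_sqrt_divide)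
    ultimately show ?case by linarith
  qed
  have "1 < 2 / sqrt 3"
    by (simp add: real_less_lsqrt)
  then obtain n where n: "(f b - f a) / sqrt (b - a) < (2 / sqrt 3) ^ n"
    using real_arch_pow by blast
  then have "f b - f a < (2 / sqrt 3) ^ n * sqrt (b - a)"
    using \<open>a < b\<close> by (simp add: pos_divide_less_eq)
  with iterate[OF assms(3-5), of n] show False
    by linarith
qed

lemma AE_unit_interval_dense:
  assumes "AE s in restrict_space lborel {0..1}. P s" "0 \<le> a" "a < b" "b \<le> (1 :: real)"
  shows "\<exists>c. P c \<and> a \<le> c \<and> c \<le> b"
proof (rule ccontr)
  assume none: "\<not> ?thesis"
  have "AE s in lborel. s \<in> {0..1} \<longrightarrow> P s"
    using assms(1) by (simp add: AE_restrict_space_iff)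
  then have "AE s in lborel. s \<notin> {a..b}"
    by eventually_elim (use none assms(2-4) in auto)
  then have "emeasure lborel {a..b} = 0"
    by (subst (asm) AE_iff_measurable[where N = "{a..b}"]) auto
  then show False
    using \<open>a < b\<close> by simp
qed

section \<open>The source and target measures\<close>

lemma measurable_coordinates [measurable]:
  "fst \<in> borel_measurable (borel :: (real \<times> real) measure)"
  "snd \<in> borel_measurable (borel :: (real \<times> real) measure)"
  unfolding borel_prod[symmetric] by measurable

lemma measurable_i0 [measurable]: "i0 \<in> borel_measurable borel"
  unfolding i0_def by (subst borel_prod[symmetric]) measurable

lemma measurable_i1 [measurable]: "i1 \<in> borel_measurable borel"
  unfolding i1_def by (subst borel_prod[symmetric]) measurable

lemma sets_mu_bar [simp, measurable_cong]: "sets mu_bar = sets borel"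
  by (simp add: mu_bar_def)

lemma sets_nu_bar [simp, measurable_cong]: "sets nu_bar = sets borel"
  by (simp add: nu_bar_def)

lemma space_mu_bar [simp]: "space mu_bar = UNIV"
  by (simp add: mu_bar_def)

lemma prob_space_mu_bar: "prob_space mu_bar"
  unfolding mu_bar_def
proof (rule prob_space.prob_space_distr)
  show "prob_space (restrict_space lborel {0..1 :: real})"
    by (rule prob_spaceI) (simp add: emeasure_restrict_space)
qed (auto intro: measurable_restrict_space1)

lemma AE_mu_bar: "AE x in mu_bar. 0 \<le> fst x \<and> fst x \<le> 1 \<and> snd x = 0"
  unfolding mu_bar_def
proof (subst AE_distr_iff)
  show "AE s in restrict_space lborel {0..1}. 0 \<le> fst (i0 s) \<and> fst (i0 s) \<le> 1 \<and> snd (i0 s) = 0"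
    by (auto simp: i0_def AE_restrict_space_iff)
qed (simp_all add: measurable_restrict_space1)

text \<open>
  On the right, the push-forward along the identity regards the restricted measure as a Borel
  measure on the whole line, so that both sides can be composed with \<^const>\<open>i1\<close>.
\<close>

lemma distr_translate_unit_interval:
  "distr (restrict_space lborel {0..1}) borel (\<lambda>s. s + 1) =
     distr (restrict_space lborel {1..2 :: real}) borel (\<lambda>s. s)"
proof (rule measure_eqI)
  fix A :: "real set"
  assume "A \<in> sets (distr (restrict_space lborel {0..1}) borel (\<lambda>s. s + 1))"
  then have A: "A \<in> sets borel" by simp
  have "emeasure lborel (A \<inter> {1..2}) = emeasure (distr lborel borel ((+) 1)) (A \<inter> {1..2})"
    by (simp add: lborel_distr_plus)
  also have "\<dots> = emeasure lborel ((\<lambda>s. s + 1) -` A \<inter> {0..1})"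
    using A by (subst emeasure_distr) (auto intro!: arg_cong[of _ _ "emeasure lborel"] simp: add.commute)
  finally show "emeasure (distr (restrict_space lborel {0..1}) borel (\<lambda>s. s + 1)) A =
      emeasure (distr (restrict_space lborel {1..2}) borel (\<lambda>s. s)) A"
    using A by (simp add: emeasure_distr measurable_restrict_space1 emeasure_restrict_space
        space_restrict_space)
qed simp

lemma nu_bar_eq_translate: "nu_bar = distr mu_bar borel (\<lambda>x. x + (1, 1))"
proof -
  have "nu_bar = distr (distr (restrict_space lborel {1..2}) borel (\<lambda>s. s)) borel i1"
    unfolding nu_bar_def
    by (subst distr_distr) (auto intro: measurable_restrict_space1 simp: o_def)
  also have "\<dots> = distr (distr (restrict_space lborel {0..1}) borel (\<lambda>s. s + 1)) borel i1"
    by (simp only: distr_translate_unit_interval)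
  also have "\<dots> = distr (restrict_space lborel {0..1}) borel (\<lambda>s. i0 s + (1, 1))"
    by (subst distr_distr) (auto intro: measurable_restrict_space1 simp: o_def i0_def i1_def)
  also have "\<dots> = distr mu_bar borel (\<lambda>x. x + (1, 1))"
    unfolding mu_bar_def
    by (subst distr_distr) (auto intro: measurable_restrict_space1 simp: o_def)
  finally show ?thesis .
qed

section \<open>The optimal coupling\<close>

definition translation_coupling :: "((real \<times> real) \<times> (real \<times> real)) measure" where
  "translation_coupling = distr mu_bar (borel \<Otimes>\<^sub>M borel) (\<lambda>x. (x, x + (1, 1)))"

lemma translation_coupling_in_couplings: "translation_coupling \<in> couplings mu_bar nu_bar"
proof -
  have "distr translation_coupling mu_bar fst = distr mu_bar mu_bar (\<lambda>x. x)"
    unfolding translation_coupling_def by (subst distr_distr) (auto simp: o_def)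
  moreover have "distr translation_coupling nu_bar snd = distr mu_bar borel (\<lambda>x. x + (1, 1))"
    unfolding translation_coupling_def
    by (subst distr_distr) (auto simp: o_def intro!: distr_cong)
  moreover have "sets translation_coupling = sets (mu_bar \<Otimes>\<^sub>M nu_bar)"
    unfolding translation_coupling_def by (simp cong: sets_pair_measure_cong)
  ultimately show ?thesis
    by (simp add: couplings_def nu_bar_eq_translate[symmetric] distr_id)
qed

lemma c_L_eq:
  "c_L x y = (if \<bar>fst y - fst x\<bar> \<le> snd y - snd x
     then ereal (- sqrt ((snd y - snd x)\<^sup>2 - (fst y - fst x)\<^sup>2)) else \<infinity>)"
  by (simp add: c_L_def split: prod.splits)

lemma measurable_c_L:
  "(\<lambda>w. c_L (fst w) (snd w)) \<in> borel_measurable (borel \<Otimes>\<^sub>M borel)"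
  unfolding c_L_eq borel_prod[symmetric, where 'a = real and 'b = real] by measurable

lemma c_L_translate [simp]: "c_L x (x + (1, 1)) = 0"
  by (simp add: c_L_eq)

lemma transport_cost_translation_coupling: "transport_cost c_L translation_coupling = 0"
proof -
  note measurable_c_L[measurable]
  show ?thesis
    unfolding transport_cost_def translation_coupling_def case_prod_beta
    by (simp add: nn_integral_distr)
qed

text \<open>
  For a coupling of finite cost the slack in the causality constraint (the function \<open>?gap\<close>) is
  nonnegative. Its integral depends only on the marginals of the coupling, and vanishes because the
  second marginal is the first one translated by \<open>(1, 1)\<close>; so the constraint is saturated almost
  everywhere.
\<close>

lemma coupling_in_future_is_translation:
  assumes "\<pi> \<in> couplings mu_bar nu_bar" and "AE w in \<pi>. c_L (fst w) (snd w) \<noteq> \<infinity>"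
  shows "AE w in \<pi>. snd w = fst w + (1, 1)"
proof -
  have sets_\<pi> [measurable_cong]: "sets \<pi> = sets (borel \<Otimes>\<^sub>M borel)"
    using assms(1) by (auto simp: couplings_def cong: sets_pair_measure_cong)
  have mu: "distr \<pi> mu_bar fst = mu_bar" and nu: "distr \<pi> nu_bar snd = nu_bar"
    using assms(1) by (auto simp: couplings_def)
  have m1 [measurable]: "fst \<in> measurable \<pi> mu_bar"
    and m2 [measurable]: "snd \<in> measurable \<pi> nu_bar"
    by measurable
  interpret mu: prob_space mu_bar by (rule prob_space_mu_bar)
  have AE_nu: "AE y in nu_bar. 1 \<le> fst y \<and> fst y \<le> 2 \<and> snd y = 1"
    unfolding nu_bar_eq_translate using AE_mu_bar by (subst AE_distr_iff) auto
  have int_mu: "integrable mu_bar fst"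
    by (rule mu.integrable_const_bound[where B = 1]) (use AE_mu_bar in auto)
  have AE1: "AE w in \<pi>. 0 \<le> fst (fst w) \<and> fst (fst w) \<le> 1 \<and> snd (fst w) = 0"
    using AE_distrD[OF m1, of "\<lambda>x. 0 \<le> fst x \<and> fst x \<le> 1 \<and> snd x = 0", unfolded mu] AE_mu_bar
    by blast
  have AE2: "AE w in \<pi>. 1 \<le> fst (snd w) \<and> fst (snd w) \<le> 2 \<and> snd (snd w) = 1"
    using AE_distrD[OF m2, of "\<lambda>y. 1 \<le> fst y \<and> fst y \<le> 2 \<and> snd y = 1", unfolded nu] AE_nu
    by blast
  have int_nu: "integrable nu_bar fst" and "integral\<^sup>L nu_bar fst = integral\<^sup>L mu_bar fst + 1"
    using int_mu unfolding nu_bar_eq_translate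
    by (auto simp: integrable_distr_eq integral_distr mu.prob_space[simplified])
  have i1: "integrable \<pi> (\<lambda>w. fst (fst w))"
    using int_mu by (subst (asm) mu[symmetric]) (simp add: integrable_distr_eq)
  have i2: "integrable \<pi> (\<lambda>w. fst (snd w))"
    using int_nu by (subst (asm) nu[symmetric]) (simp add: integrable_distr_eq)
  interpret prob_space \<pi>
    using prob_space_distrD[OF m1] mu prob_space_mu_bar by simp
  let ?gap = "\<lambda>w. fst (fst w) + 1 - fst (snd w) :: real"
  have "integral\<^sup>L \<pi> (\<lambda>w. fst (fst w)) = integral\<^sup>L mu_bar fst"
    using integral_distr[OF m1, of fst] mu by simp
  moreover have "integral\<^sup>L \<pi> (\<lambda>w. fst (snd w)) = integral\<^sup>L nu_bar fst"
    using integral_distr[OF m2, of fst] nu by simp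
  ultimately have "integral\<^sup>L \<pi> ?gap = 0"
    using i1 i2 \<open>integral\<^sup>L nu_bar fst = integral\<^sup>L mu_bar fst + 1\<close> by (simp add: prob_space)
  moreover have "integrable \<pi> ?gap"
    using i1 i2 by simp
  moreover have "AE w in \<pi>. 0 \<le> ?gap w"
    using AE1 AE2 assms(2) by eventually_elim (auto simp: c_L_eq split: if_splits)
  ultimately have "AE w in \<pi>. ?gap w = 0"
    using integral_nonneg_eq_0_iff_AE by blast
  with AE1 AE2 show ?thesis
    by eventually_elim (auto simp: prod_eq_iff)
qed

text \<open>
  A competitor either charges the region of infinite cost, and then its positive part has infinite
  integral, or it is concentrated on the same graph as the translation and costs 0 as well.
\<close>

lemma optimal_translation_coupling: "optimal_coupling c_L mu_bar nu_bar translation_coupling"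
  unfolding optimal_coupling_def
proof (intro conjI ballI translation_coupling_in_couplings)
  fix \<pi> assume \<pi>: "\<pi> \<in> couplings mu_bar nu_bar"
  note measurable_c_L[measurable]
  have sets_\<pi> [measurable_cong]: "sets \<pi> = sets (borel \<Otimes>\<^sub>M borel)"
    using \<pi> by (auto simp: couplings_def cong: sets_pair_measure_cong)
  show "transport_cost c_L translation_coupling \<le> transport_cost c_L \<pi>"
  proof (cases "(\<integral>\<^sup>+ w. e2ennreal (c_L (fst w) (snd w)) \<partial>\<pi>) = \<infinity>")
    case True
    then show ?thesis
      unfolding transport_cost_def case_prod_beta by simp
  next
    case False
    have "AE w in \<pi>. e2ennreal (c_L (fst w) (snd w)) \<noteq> \<infinity>"
      by (rule nn_integral_PInf_AE[OF _ False]) measurable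
    then have "AE w in \<pi>. c_L (fst w) (snd w) \<noteq> \<infinity>"
      by eventually_elim auto
    then have "AE w in \<pi>. snd w = fst w + (1, 1)"
      by (rule coupling_in_future_is_translation[OF \<pi>])
    then have zero: "AE w in \<pi>. c_L (fst w) (snd w) = 0"
      by eventually_elim simp
    have "(\<integral>\<^sup>+ w. e2ennreal (c_L (fst w) (snd w)) \<partial>\<pi>) = (\<integral>\<^sup>+ w. 0 \<partial>\<pi>)"
      using zero by (intro nn_integral_cong_AE) (auto elim!: eventually_mono)
    moreover have "(\<integral>\<^sup>+ w. e2ennreal (- c_L (fst w) (snd w)) \<partial>\<pi>) = (\<integral>\<^sup>+ w. 0 \<partial>\<pi>)"
      using zero by (intro nn_integral_cong_AE) (auto elim!: eventually_mono)
    ultimately have "transport_cost c_L \<pi> = 0"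
      unfolding transport_cost_def case_prod_beta by simp
    then show ?thesis
      by (simp add: transport_cost_translation_coupling)
  qed
qed

section \<open>Nonexistence of a dual solution\<close>

text \<open>
  Moving the starting point from \<open>a\<close> to \<open>b\<close> tilts the light ray from \<open>(a, 0)\<close> to \<open>(a + 1, 1)\<close>
  into a timelike segment, whose length is of the order of the square root of the displacement.
\<close>

lemma c_L_neighbour_le:
  assumes "a < b" "b \<le> a + 1"
  shows "c_L (i0 b) (i1 (a + 1)) \<le> ereal (- sqrt (b - a))"
proof -
  have "(b - a) * (b - a) \<le> 1 * (b - a)"
    using assms by (intro mult_right_mono) auto
  then have "b - a \<le> 1 - (a + 1 - b)\<^sup>2"
    by (simp add: power2_eq_square algebra_simps)
  then show ?thesis
    using assms by (simp add: c_L_eq i0_def i1_def)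
qed

theorem proposition3p1:
  shows "\<not> (\<exists>\<psi>. DKP_solution c_L mu_bar nu_bar \<psi>)"
proof
  assume "\<exists>\<psi>. DKP_solution c_L mu_bar nu_bar \<psi>"
  then obtain \<psi> where finite: "AE x in mu_bar. \<bar>\<psi> x\<bar> \<noteq> \<infinity>"
    and tight: "AE w in translation_coupling. ereal_diff (c_transform c_L \<psi> (snd w)) (\<psi> (fst w)) =
        c_L (fst w) (snd w)"
    using optimal_translation_coupling by (auto simp: DKP_solution_def case_prod_beta)
  have "AE x in mu_bar. ereal_diff (c_transform c_L \<psi> (x + (1, 1))) (\<psi> x) = 0"
    using AE_distrD[OF _ tight[unfolded translation_coupling_def]] by simp
  with finite have "AE x in mu_bar. \<bar>\<psi> x\<bar> \<noteq> \<infinity> \<and> c_transform c_L \<psi> (x + (1, 1)) = \<psi> x"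
  proof eventually_elim
    case (elim x)
    then show ?case
      by (cases "\<psi> x"; cases "c_transform c_L \<psi> (x + (1, 1))")
        (auto simp: ereal_diff_def zero_ereal_def)
  qed
  then have "AE s in restrict_space lborel {0..1}.
      \<bar>\<psi> (i0 s)\<bar> \<noteq> \<infinity> \<and> c_transform c_L \<psi> (i0 s + (1, 1)) = \<psi> (i0 s)"
    unfolding mu_bar_def by (rule AE_distrD[rotated]) (simp add: measurable_restrict_space1)
  then have good: "AE s in restrict_space lborel {0..1}.
      \<bar>\<psi> (i0 s)\<bar> \<noteq> \<infinity> \<and> c_transform c_L \<psi> (i1 (s + 1)) = \<psi> (i0 s)"
    by (simp add: i0_def i1_def)
  define G where "G = {s \<in> {0..1}. \<bar>\<psi> (i0 s)\<bar> \<noteq> \<infinity> \<and> c_transform c_L \<psi> (i1 (s + 1)) = \<psi> (i0 s)}"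
  define f where "f s = real_of_ereal (\<psi> (i0 s))" for s
  have G_meets: "\<exists>c\<in>G. a \<le> c \<and> c \<le> b" if "0 \<le> a" "a < b" "b \<le> 1" for a b
    using AE_unit_interval_dense[OF good that] that by (fastforce simp: G_def)
  have "sqrt (b - a) \<le> f b - f a" if "a \<in> G" "b \<in> G" "a < b" for a b
  proof -
    have "\<psi> (i0 a) = c_transform c_L \<psi> (i1 (a + 1))"
      using that by (simp add: G_def)
    also have "\<dots> \<le> \<psi> (i0 b) + c_L (i0 b) (i1 (a + 1))"
      unfolding c_transform_def by (rule INF_lower) simp
    also have "\<dots> \<le> \<psi> (i0 b) + ereal (- sqrt (b - a))"
      using that by (intro add_left_mono c_L_neighbour_le) (auto simp: G_def)
    finally show ?thesis
      using that by (cases "\<psi> (i0 a)"; cases "\<psi> (i0 b)") (auto simp: f_def G_def)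
  qed
  moreover have "\<exists>c\<in>G. a + (b - a) / 3 \<le> c \<and> c \<le> b - (b - a) / 3"
    if "a \<in> G" "b \<in> G" "a < b" for a b
    using that by (intro G_meets) (auto simp: G_def field_simps)
  moreover obtain a where "a \<in> G" "a \<le> 1 / 3"
    using G_meets[of 0 "1 / 3"] by auto
  moreover obtain b where "b \<in> G" "2 / 3 \<le> b"
    using G_meets[of "2 / 3" 1] by auto
  ultimately show False
    using no_sqrt_expanding_function[of G f a b] by auto
qed

end
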